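(* The tetrahedron, i.e. the complete graph on 4 vertices, is an integrable graph.
   Context: Let $H$ denote three-dimensional hyperbolic space (constant curvature $-1$) with distance function $d$ and Riemannian volume measure $\mathrm{d}x$ (in geodesic spherical coordinates about a point, $\mathrm{d}x=\sinh^2 r\,\mathrm{d}r\,\mathrm{d}\Omega$, with $\mathrm{d}\Omega$ Lebesgue measure on the unit 2-sphere). For $p\ge 0$ and $x,y\in H$ with $r=d(x,y)$, put $K_p(x,y)=K_p(r)=\frac{\sin pr}{p\sinh r}$ for $p,r>0$, extended continuously to $p,r\ge 0$: $K_p(0)=1$ and $K_0(r)=r/\sinh r$. Graphs are finite and connected. Let $\Gamma$ be such a graph with vertex set $V$ and edge set $E$, and let $p\colon E\to[0,\infty)$ be a labelling of the edges. Let $s(e),t(e)$ be the two endpoints of $e\in E$ (in either order; $K_p$ is symmetric), choose a vertex $w\in V$ and a point $x_w\in H$, and let $V'=V\setminus\{w\}$. The labelled graph $(\Gamma,p)$ (a relativistic spin network) is called integrable if $$\int_{H^{V'}}\Big|\prod_{e\in E}K_{p(e)}(x_{s(e)},x_{t(e)})\Big|\prod_{v\in V'}\mathrm{d}x_v<\infty .$$ By invariance under the isometries of $H$ this does not depend on the choice of $w$ and $x_w$. The graph $\Gamma$ is called integrable if $(\Gamma,p)$ is integrable for every choice of edge labels $p\colon E\to[0,\infty)$. *)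

theory Defs
  imports "HOL-Analysis.Analysis"
begin

text \<open>
  Upper half-space model: the points \<open>(x, y, z)\<close> with \<open>z > 0\<close>, with the Riemannian metric
  \<open>(dx^2 + dy^2 + dz^2) / z^2\<close> of constant curvature \<open>-1\<close>. Its distance is given by
  \<open>cosh d = 1 + |P - Q|^2 / (2 z(P) z(Q))\<close> with the Euclidean norm on the right (which is
  the norm of the product type), and its volume element is \<open>dx dy dz / z^3\<close>.
\<close>

type_synonym point = "real \<times> real \<times> real"

definition height :: "point \<Rightarrow> real"
  where "height P = snd (snd P)"

definition hyp_space :: "point set"
  where "hyp_space = {P. height P > 0}"

definition hyp_dist :: "point \<Rightarrow> point \<Rightarrow> real"
  where "hyp_dist P Q = arcosh (1 + (norm (P - Q))\<^sup>2 / (2 * height P * height Q))"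

definition hyp_volume :: "point measure"
  where "hyp_volume = density (restrict_space lborel hyp_space) (\<lambda>P. ennreal (1 / height P ^ 3))"

definition kernel_fun :: "real \<Rightarrow> real \<Rightarrow> real"
  where "kernel_fun p r =
    (if r = 0 then 1 else if p = 0 then r / sinh r else sin (p * r) / (p * sinh r))"

definition kernel :: "real \<Rightarrow> point \<Rightarrow> point \<Rightarrow> real"
  where "kernel p P Q = kernel_fun p (hyp_dist P Q)"

text \<open>
  A graph has vertex set \<open>V\<close> and edge set \<open>E\<close>; the endpoints of an edge \<open>e\<close> are \<open>s e\<close> and \<open>t e\<close>,
  listed in an arbitrary order that carries no meaning. Loops and multiple edges are not excluded.
\<close>

definition finite_connected_graph :: "'v set \<Rightarrow> 'e set \<Rightarrow> ('e \<Rightarrow> 'v) \<Rightarrow> ('e \<Rightarrow> 'v) \<Rightarrow> bool"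
  where "finite_connected_graph V E s t \<longleftrightarrow>
    finite V \<and> V \<noteq> {} \<and> finite E \<and> s ` E \<subseteq> V \<and> t ` E \<subseteq> V \<and>
    (\<forall>u\<in>V. \<forall>v\<in>V. (u, v) \<in> ((\<lambda>e. (s e, t e)) ` E \<union> (\<lambda>e. (t e, s e)) ` E)\<^sup>*)"

text \<open>
  Integrability does not depend on the choice of the vertex \<open>w\<close> and of its position \<open>a\<close>;
  the definition asks for finiteness of the integral for every choice.
\<close>

definition integrable_network ::
    "'v set \<Rightarrow> 'e set \<Rightarrow> ('e \<Rightarrow> 'v) \<Rightarrow> ('e \<Rightarrow> 'v) \<Rightarrow> ('e \<Rightarrow> real) \<Rightarrow> bool"
  where "integrable_network V E s t p \<longleftrightarrow>
    (\<forall>w\<in>V. \<forall>a\<in>hyp_space.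
      (\<integral>\<^sup>+ x. ennreal \<bar>\<Prod>e\<in>E. kernel (p e) ((x(w := a)) (s e)) ((x(w := a)) (t e))\<bar>
        \<partial>(\<Pi>\<^sub>M v\<in>V - {w}. hyp_volume)) < \<infinity>)"

definition integrable_graph :: "'v set \<Rightarrow> 'e set \<Rightarrow> ('e \<Rightarrow> 'v) \<Rightarrow> ('e \<Rightarrow> 'v) \<Rightarrow> bool"
  where "integrable_graph V E s t \<longleftrightarrow>
    finite_connected_graph V E s t \<and>
    (\<forall>p. (\<forall>e\<in>E. 0 \<le> p e) \<longrightarrow> integrable_network V E s t p)"

definition complete_graph :: "'v set \<Rightarrow> 'e set \<Rightarrow> ('e \<Rightarrow> 'v) \<Rightarrow> ('e \<Rightarrow> 'v) \<Rightarrow> bool"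
  where "complete_graph V E s t \<longleftrightarrow>
    bij_betw (\<lambda>e. {s e, t e}) E {U. U \<subseteq> V \<and> card U = 2}"

end

theory Submission
  imports Defs
begin

text \<open>
  Write \<open>q = 1 / cosh d\<close>. Then \<open>\<bar>K\<^sub>p\<bar> \<le> K\<^sub>0 \<le> C q\<^sup>s\<close> for every \<open>s < 1\<close>, so it suffices to integrate
  powers of \<open>q\<close>. The key estimate is
  \<open>\<integral> (q(x,P) q(x,Q))\<^sup>t dx \<le> C q(P,Q)\<^bsup>t-\<epsilon>\<^esup>\<close> for \<open>t > 1\<close> and \<open>0 < \<epsilon> \<le> t\<close>. In the upper half-space
  \<open>q\<close> is a quotient of quadratic polynomials, and Feynman parametrization merges the two denominators
  into a single centred quadratic form, after which the integral over \<open>x\<close> is a matter of scaling.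

  A three-point integral is bounded by the geometric mean of its three two-point integrals. With
  \<open>s = 8/9\<close> and \<open>\<epsilon> = 1/3\<close>, integrating out the first vertex gives \<open>q\<^bsup>1/3\<^esup>\<close> on each edge of the
  opposite triangle, whose edges then carry \<open>q\<^bsup>11/9\<^esup>\<close>; integrating out the second gives \<open>q\<^bsup>8/9\<^esup>\<close>
  on the last edge, which then carries \<open>q\<^bsup>19/9\<^esup>\<close>. This is integrable because \<open>19/9 > 2\<close>.
\<close>

section \<open>Scaling integrals\<close>

text \<open>\<open>ennreal\<close> cuts off negative values, so it is enough to dominate
  \<open>f\<close> from above by one power integrable at 0 and one integrable at infinity. Every
  one-dimensional convergence question below reduces to this test.\<close>

lemma nn_integral_powr_comparison:
  fixes f :: "real \<Rightarrow> real"
  assumes "0 < a" "0 < b"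
    and neg: "\<And>x. x \<le> 0 \<Longrightarrow> f x \<le> 0"
    and small: "\<And>x. 0 < x \<Longrightarrow> x \<le> 1 \<Longrightarrow> f x \<le> x powr (a - 1)"
    and large: "\<And>x. 1 \<le> x \<Longrightarrow> f x \<le> x powr (- b - 1)"
  shows "(\<integral>\<^sup>+x. ennreal (f x) \<partial>lborel) < \<infinity>"
proof -
  let ?g = "\<lambda>x::real. if x \<in> {0..1} then x powr (a - 1) else 0"
  let ?h = "\<lambda>x::real. if x \<in> {1..} then x powr (- b - 1) else 0"
  have "((\<lambda>x. x powr (a - 1)) has_integral (1 powr (a - 1 + 1) / (a - 1 + 1))) {0..1}"
    using \<open>0 < a\<close> by (intro has_integral_powr_from_0) auto
  then have "(?g has_integral (1 / a)) UNIV"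
    by (subst has_integral_restrict_UNIV) simp
  then have g: "(\<integral>\<^sup>+x. ennreal (?g x) \<partial>lborel) = ennreal (1 / a)"
    by (intro nn_integral_has_integral_lborel) auto
  have "((\<lambda>x. x powr (- b - 1)) has_integral (- (1 powr (- b - 1 + 1)) / (- b - 1 + 1))) {1..}"
    using \<open>0 < b\<close> by (intro has_integral_powr_to_inf) auto
  then have "(?h has_integral (1 / b)) UNIV"
    by (subst has_integral_restrict_UNIV) simp
  then have h: "(\<integral>\<^sup>+x. ennreal (?h x) \<partial>lborel) = ennreal (1 / b)"
    by (intro nn_integral_has_integral_lborel) auto
  have "(\<integral>\<^sup>+x. ennreal (f x) \<partial>lborel) \<le> (\<integral>\<^sup>+x. ennreal (?g x) + ennreal (?h x) \<partial>lborel)"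
  proof (intro nn_integral_mono)
    fix x :: real
    have "f x \<le> ?g x + ?h x"
      using neg[of x] small[of x] large[of x] by (cases "x \<le> 0"; cases "x \<le> 1") auto
    then have "ennreal (f x) \<le> ennreal (?g x + ?h x)"
      by (rule ennreal_leI)
    also have "\<dots> = ennreal (?g x) + ennreal (?h x)"
      by (intro ennreal_plus) auto
    finally show "ennreal (f x) \<le> ennreal (?g x) + ennreal (?h x)" .
  qed
  also have "\<dots> = (\<integral>\<^sup>+x. ennreal (?g x) \<partial>lborel) + (\<integral>\<^sup>+x. ennreal (?h x) \<partial>lborel)"
    by (intro nn_integral_add) auto
  also have "\<dots> < \<infinity>"
    by (simp only: g h) simp
  finally show ?thesis .
qed

text \<open>The substitution \<open>y = c + sqrt N * u\<close> contributes \<open>sqrt N\<close> and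
  turns the integrand into \<open>N powr - \<kappa>\<close> times the standard one with
  \<open>c = 0\<close> and \<open>N = 1\<close>. The constant is the standard integral; its value is
  irrelevant, but it must be the same for all \<open>c\<close> and \<open>N\<close>.\<close>

lemma nn_integral_inverse_quadratic_powr:
  assumes "1/2 < \<kappa>"
  obtains C where "0 \<le> C"
    "\<And>c N. 0 < N \<Longrightarrow>
      (\<integral>\<^sup>+y. ennreal (((y - c)\<^sup>2 + N) powr - \<kappa>) \<partial>lborel) = ennreal (C * N powr (1/2 - \<kappa>))"
proof -
  let ?f = "\<lambda>y::real. (y\<^sup>2 + 1) powr - \<kappa>"
  \<comment> \<open>The comparison test treats a half-line. The integrand is even, so it is the sum
    of \<open>g\<close> and its reflection, except at 0, where both vanish.\<close>
  define g where "g = (\<lambda>y::real. if 0 < y then ?f y else 0)"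
  have g_measurable [measurable]: "g \<in> borel_measurable borel"
    unfolding g_def by simp
  have le1: "?f y \<le> 1" for y
    using assms by (auto simp: powr_minus intro!: inverse_le_1_iff[THEN iffD2] ge_one_powr_ge_zero)
  have "(\<integral>\<^sup>+y. ennreal (g y) \<partial>lborel) < \<infinity>"
  proof (rule nn_integral_powr_comparison[of 1 "2 * \<kappa> - 1"])
    fix x :: real assume "1 \<le> x"
    then have "?f x \<le> (x\<^sup>2) powr - \<kappa>"
      using assms by (intro powr_mono2') auto
    also have "\<dots> = x powr (- (2 * \<kappa> - 1) - 1)"
      using \<open>1 \<le> x\<close> by (simp add: powr_powr flip: powr_numeral)
    finally show "g x \<le> x powr (- (2 * \<kappa> - 1) - 1)"
      by (simp add: g_def)
  qed (use assms le1 in \<open>auto simp: g_def\<close>)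
  moreover have "(\<integral>\<^sup>+y. ennreal (g (- y)) \<partial>lborel) = (\<integral>\<^sup>+y. ennreal (g y) \<partial>lborel)"
    by (subst (2) nn_integral_real_affine[where c = "-1" and t = 0]) simp_all
  moreover have "(\<integral>\<^sup>+y. ennreal (?f y) \<partial>lborel) =
      (\<integral>\<^sup>+y. ennreal (g y) + ennreal (g (- y)) \<partial>lborel)"
    by (intro nn_integral_cong_AE) (use AE_lborel_singleton[of 0] in eventually_elim, auto simp: g_def)
  moreover have "\<dots> = (\<integral>\<^sup>+y. ennreal (g y) \<partial>lborel) + (\<integral>\<^sup>+y. ennreal (g (- y)) \<partial>lborel)"
    by (intro nn_integral_add) (auto simp: g_def)
  ultimately have "(\<integral>\<^sup>+y. ennreal (?f y) \<partial>lborel) < \<infinity>"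
    by simp
  then obtain C where C: "0 \<le> C" "(\<integral>\<^sup>+y. ennreal (?f y) \<partial>lborel) = ennreal C"
    by (cases "\<integral>\<^sup>+y. ennreal (?f y) \<partial>lborel" rule: ennreal_cases) auto
  have "(\<integral>\<^sup>+y. ennreal (((y - c)\<^sup>2 + N) powr - \<kappa>) \<partial>lborel) = ennreal (C * N powr (1/2 - \<kappa>))"
    if "0 < N" for c N
  proof -
    have "(\<integral>\<^sup>+y. ennreal (((y - c)\<^sup>2 + N) powr - \<kappa>) \<partial>lborel)
        = ennreal (sqrt N) * (\<integral>\<^sup>+y. ennreal (((c + sqrt N * y - c)\<^sup>2 + N) powr - \<kappa>) \<partial>lborel)"
      using that by (subst nn_integral_real_affine[where c = "sqrt N" and t = c]) auto
    also have "(\<lambda>y. (c + sqrt N * y - c)\<^sup>2 + N) = (\<lambda>y. N * (y\<^sup>2 + 1))"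
      using that by (auto simp: power_mult_distrib algebra_simps)
    also have "(\<integral>\<^sup>+y. ennreal ((N * (y\<^sup>2 + 1)) powr - \<kappa>) \<partial>lborel)
        = (\<integral>\<^sup>+y. ennreal (N powr - \<kappa>) * ennreal (?f y) \<partial>lborel)"
      using that by (intro nn_integral_cong) (simp add: powr_mult ennreal_mult'')
    also have "\<dots> = ennreal (N powr - \<kappa>) * ennreal C"
      by (subst nn_integral_cmult) (auto simp: C)
    also have "ennreal (sqrt N) * \<dots> = ennreal (C * (N powr (1/2) * N powr - \<kappa>))"
      using that C(1) by (simp add: powr_half_sqrt mult_ac flip: ennreal_mult')
    also have "N powr (1/2) * N powr - \<kappa> = N powr (1/2 - \<kappa>)"
      by (subst powr_add[symmetric], rule arg_cong[where f = "(powr) N"]) simp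
    finally show ?thesis .
  qed
  with C(1) show ?thesis by (rule that)
qed

text \<open>Scaling by \<open>sqrt N\<close> gives the total exponent
  \<open>1/2 + (t - 3/2) + (1 - 2 * t) = - t\<close>. At 0 the integrand behaves like
  \<open>z powr (2 * t - 3)\<close>, and this is the origin of the threshold \<open>1 < t\<close>;
  at infinity it decays like \<open>z powr (- 2 * t - 1)\<close>.\<close>

lemma nn_integral_vertical_powr:
  assumes "1 < t"
  obtains C where "0 \<le> C"
    "\<And>N. 0 < N \<Longrightarrow>
      (\<integral>\<^sup>+z. ennreal (if 0 < z then z powr (2 * t - 3) * (z\<^sup>2 + N) powr (1 - 2 * t) else 0) \<partial>lborel)
        = ennreal (C * N powr - t)"
proof -
  let ?f = "\<lambda>N z::real. if 0 < z then z powr (2 * t - 3) * (z\<^sup>2 + N) powr (1 - 2 * t) else 0"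
  have "(\<integral>\<^sup>+z. ennreal (?f 1 z) \<partial>lborel) < \<infinity>"
  proof (rule nn_integral_powr_comparison[of "2 * t - 2" "2 * t"])
    fix x :: real assume x: "0 < x" "x \<le> 1"
    have "(x\<^sup>2 + 1) powr (1 - 2 * t) \<le> 1 powr (1 - 2 * t)"
      using assms by (intro powr_mono2') auto
    then show "?f 1 x \<le> x powr (2 * t - 2 - 1)"
      using x by (simp add: mult_left_le)
  next
    fix x :: real assume x: "1 \<le> x"
    have "(x\<^sup>2 + 1) powr (1 - 2 * t) \<le> (x\<^sup>2) powr (1 - 2 * t)"
      using assms x by (intro powr_mono2') auto
    also have "\<dots> = x powr (2 - 4 * t)"
      using x by (simp add: powr_powr algebra_simps flip: powr_numeral)
    finally have "?f 1 x \<le> x powr (2 * t - 3) * x powr (2 - 4 * t)"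
      using x by (simp add: mult_left_mono)
    also have "\<dots> = x powr (- (2 * t) - 1)"
      by (subst powr_add[symmetric], rule arg_cong[where f = "(powr) x"]) simp
    finally show "?f 1 x \<le> x powr (- (2 * t) - 1)" .
  qed (use assms in auto)
  then obtain C where C: "0 \<le> C" "(\<integral>\<^sup>+z. ennreal (?f 1 z) \<partial>lborel) = ennreal C"
    by (cases "\<integral>\<^sup>+z. ennreal (?f 1 z) \<partial>lborel" rule: ennreal_cases) auto
  have "(\<integral>\<^sup>+z. ennreal (?f N z) \<partial>lborel) = ennreal (C * N powr - t)" if "0 < N" for N
  proof -
    have eq: "ennreal (?f N (sqrt N * z)) = ennreal (N powr (- t - 1/2)) * ennreal (?f 1 z)" for z
    proof (cases "0 < z")
      case True
      have "(sqrt N * z)\<^sup>2 + N = N * (z\<^sup>2 + 1)"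
        using that by (simp add: power_mult_distrib algebra_simps)
      then have "?f N (sqrt N * z)
          = sqrt N powr (2 * t - 3) * z powr (2 * t - 3) * (N powr (1 - 2 * t) * (z\<^sup>2 + 1) powr (1 - 2 * t))"
        using True that by (simp add: powr_mult)
      also have "sqrt N powr (2 * t - 3) = N powr (t - 3/2)"
        using that by (simp add: powr_half_sqrt[symmetric] powr_powr field_simps)
      also have "N powr (t - 3/2) * z powr (2 * t - 3) * (N powr (1 - 2 * t) * (z\<^sup>2 + 1) powr (1 - 2 * t))
          = (N powr (t - 3/2) * N powr (1 - 2 * t)) * ?f 1 z"
        using True by simp
      also have "N powr (t - 3/2) * N powr (1 - 2 * t) = N powr (- t - 1/2)"
        by (subst powr_add[symmetric], rule arg_cong[where f = "(powr) N"]) simp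
      finally have "?f N (sqrt N * z) = N powr (- t - 1/2) * ?f 1 z" .
      then have "ennreal (?f N (sqrt N * z)) = ennreal (N powr (- t - 1/2) * ?f 1 z)"
        by (rule arg_cong)
      also have "\<dots> = ennreal (N powr (- t - 1/2)) * ennreal (?f 1 z)"
        by (rule ennreal_mult') simp
      finally show ?thesis .
    qed (use that in \<open>auto simp: zero_less_mult_iff\<close>)
    have "(\<integral>\<^sup>+z. ennreal (?f N z) \<partial>lborel) = ennreal (sqrt N) * (\<integral>\<^sup>+z. ennreal (?f N (sqrt N * z)) \<partial>lborel)"
      using that by (subst nn_integral_real_affine[where c = "sqrt N" and t = 0]) (simp_all cong: if_cong)
    also have "\<dots> = ennreal (sqrt N) * (ennreal (N powr (- t - 1/2)) * ennreal C)"
      unfolding eq by (subst nn_integral_cmult) (auto simp: C)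
    also have "\<dots> = ennreal (C * (N powr (1/2) * N powr (- t - 1/2)))"
      using that C(1) by (simp add: powr_half_sqrt mult_ac flip: ennreal_mult')
    also have "N powr (1/2) * N powr (- t - 1/2) = N powr - t"
      by (subst powr_add[symmetric], rule arg_cong[where f = "(powr) N"]) simp
    finally show ?thesis .
  qed
  with C(1) show ?thesis by (rule that)
qed

lemma nn_integral_lborel_prod_snd:
  fixes f :: "'a::euclidean_space \<times> 'b::euclidean_space \<Rightarrow> ennreal"
  assumes "f \<in> borel_measurable borel"
  shows "(\<integral>\<^sup>+p. f p \<partial>lborel) = (\<integral>\<^sup>+y. (\<integral>\<^sup>+x. f (x, y) \<partial>lborel) \<partial>lborel)"
  using lborel_pair.nn_integral_snd[of f] assms by (simp add: lborel_prod)

text \<open>The weight \<open>z powr (2 * t - 3)\<close> joins the volume factor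
  \<open>1 / z ^ 3\<close> to the heights in the numerators of two factors \<open>sech_dist\<close>,
  raised to the power \<open>t\<close>. Each horizontal integration raises the exponent of the
  quadratic form by 1/2, so that \<open>- 2 * t\<close> becomes the \<open>1 - 2 * t\<close> of the
  vertical integral.\<close>

lemma nn_integral_half_space_powr:
  assumes "1 < t"
  obtains C where "0 \<le> C"
    "\<And>c d N. 0 < N \<Longrightarrow>
      (\<integral>\<^sup>+(x, y, z). ennreal (if 0 < z
          then z powr (2 * t - 3) * ((x - c)\<^sup>2 + (y - d)\<^sup>2 + z\<^sup>2 + N) powr (- 2 * t) else 0) \<partial>lborel)
        = ennreal (C * N powr - t)"
proof -
  have "1/2 < 2 * t" "1/2 < 2 * t - 1/2"
    using assms by auto
  from nn_integral_inverse_quadratic_powr[OF this(1)] nn_integral_inverse_quadratic_powr[OF this(2)]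
  obtain C\<^sub>1 C\<^sub>2 where C\<^sub>1: "0 \<le> C\<^sub>1"
      "\<And>c N. 0 < N \<Longrightarrow> (\<integral>\<^sup>+y. ennreal (((y - c)\<^sup>2 + N) powr - (2 * t)) \<partial>lborel)
        = ennreal (C\<^sub>1 * N powr (1/2 - 2 * t))"
    and C\<^sub>2: "0 \<le> C\<^sub>2"
      "\<And>c N. 0 < N \<Longrightarrow> (\<integral>\<^sup>+y. ennreal (((y - c)\<^sup>2 + N) powr - (2 * t - 1/2)) \<partial>lborel)
        = ennreal (C\<^sub>2 * N powr (1/2 - (2 * t - 1/2)))"
    by metis
  obtain C\<^sub>3 where C\<^sub>3: "0 \<le> C\<^sub>3"
      "\<And>N. 0 < N \<Longrightarrow>
      (\<integral>\<^sup>+z. ennreal (if 0 < z then z powr (2 * t - 3) * (z\<^sup>2 + N) powr (1 - 2 * t) else 0) \<partial>lborel)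
        = ennreal (C\<^sub>3 * N powr - t)"
    using nn_integral_vertical_powr[OF assms] by blast
  have "(\<integral>\<^sup>+(x, y, z). ennreal (if 0 < z
          then z powr (2 * t - 3) * ((x - c)\<^sup>2 + (y - d)\<^sup>2 + z\<^sup>2 + N) powr (- 2 * t) else 0) \<partial>lborel)
        = ennreal (C\<^sub>1 * C\<^sub>2 * C\<^sub>3 * N powr - t)" if "0 < N" for c d N
  proof -
    let ?f = "\<lambda>x y z. if 0 < z
          then z powr (2 * t - 3) * ((x - c)\<^sup>2 + (y - d)\<^sup>2 + z\<^sup>2 + N) powr (- 2 * t) else 0"
    let ?g = "\<lambda>y z. if 0 < z
          then C\<^sub>1 * z powr (2 * t - 3) * ((y - d)\<^sup>2 + (z\<^sup>2 + N)) powr - (2 * t - 1/2) else 0"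
    let ?h = "\<lambda>z. if 0 < z then z powr (2 * t - 3) * (z\<^sup>2 + N) powr (1 - 2 * t) else 0"
    have pos: "0 < z\<^sup>2 + N" "0 < y\<^sup>2 + z\<^sup>2 + N" for y z
      using that by (auto intro: add_nonneg_pos)
    have f: "(\<integral>\<^sup>+x. ennreal (?f x y z) \<partial>lborel) = ennreal (?g y z)" for y z
    proof (cases "0 < z")
      case True
      then have "(\<integral>\<^sup>+x. ennreal (?f x y z) \<partial>lborel)
          = (\<integral>\<^sup>+x. ennreal (z powr (2 * t - 3)) *
              ennreal (((x - c)\<^sup>2 + ((y - d)\<^sup>2 + z\<^sup>2 + N)) powr - (2 * t)) \<partial>lborel)"
        by (intro nn_integral_cong) (simp add: ennreal_mult' add.assoc)
      also have "\<dots> = ennreal (z powr (2 * t - 3)) * ennreal (C\<^sub>1 * ((y - d)\<^sup>2 + z\<^sup>2 + N) powr (1/2 - 2 * t))"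
        using C\<^sub>1(2)[OF pos(2)] by (subst nn_integral_cmult) auto
      also have "\<dots> = ennreal (?g y z)"
        using True by (simp add: ennreal_mult'[symmetric] mult_ac add.assoc)
      finally show ?thesis .
    qed simp
    have g: "(\<integral>\<^sup>+y. ennreal (?g y z) \<partial>lborel) = ennreal (C\<^sub>1 * C\<^sub>2) * ennreal (?h z)" for z
    proof (cases "0 < z")
      case True
      then have "(\<integral>\<^sup>+y. ennreal (?g y z) \<partial>lborel)
          = (\<integral>\<^sup>+y. ennreal (C\<^sub>1 * z powr (2 * t - 3)) *
              ennreal (((y - d)\<^sup>2 + (z\<^sup>2 + N)) powr - (2 * t - 1/2)) \<partial>lborel)"
        using C\<^sub>1(1) by (intro nn_integral_cong) (simp add: ennreal_mult')
      also have "\<dots> = ennreal (C\<^sub>1 * z powr (2 * t - 3)) * ennreal (C\<^sub>2 * (z\<^sup>2 + N) powr (1/2 - (2 * t - 1/2)))"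
        using C\<^sub>2(2)[OF pos(1)] by (subst nn_integral_cmult) auto
      also have "\<dots> = ennreal (C\<^sub>1 * C\<^sub>2) * ennreal (?h z)"
        using True C\<^sub>1(1) C\<^sub>2(1) by (simp add: ennreal_mult'[symmetric] mult_ac)
      finally show ?thesis .
    qed simp
    have "(\<lambda>(x, y, z). ennreal (?f x y z)) \<in> borel_measurable (borel \<Otimes>\<^sub>M borel \<Otimes>\<^sub>M borel)"
      by measurable
    then have "(\<integral>\<^sup>+(x, y, z). ennreal (?f x y z) \<partial>lborel)
        = (\<integral>\<^sup>+p. (\<integral>\<^sup>+x. (case (x, p) of (x, y, z) \<Rightarrow> ennreal (?f x y z)) \<partial>lborel) \<partial>lborel)"
      by (intro nn_integral_lborel_prod_snd) (simp add: borel_prod)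
    also have "\<dots> = (\<integral>\<^sup>+(y, z). ennreal (?g y z) \<partial>lborel)"
      by (rule nn_integral_cong) (simp only: split_paired_all prod.case f)
    also have "\<dots> = (\<integral>\<^sup>+z. (\<integral>\<^sup>+y. (case (y, z) of (y, z) \<Rightarrow> ennreal (?g y z)) \<partial>lborel) \<partial>lborel)"
    proof (rule nn_integral_lborel_prod_snd)
      have "(\<lambda>(y, z). ennreal (?g y z)) \<in> borel_measurable (borel \<Otimes>\<^sub>M borel)"
        by measurable
      then show "(\<lambda>(y, z). ennreal (?g y z)) \<in> borel_measurable borel"
        by (simp add: borel_prod)
    qed
    also have "\<dots> = (\<integral>\<^sup>+z. ennreal (C\<^sub>1 * C\<^sub>2) * ennreal (?h z) \<partial>lborel)"
      by (simp only: prod.case g)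
    also have "\<dots> = ennreal (C\<^sub>1 * C\<^sub>2) * ennreal (C\<^sub>3 * N powr - t)"
      using C\<^sub>3(2)[OF that] by (subst nn_integral_cmult) auto
    also have "\<dots> = ennreal (C\<^sub>1 * C\<^sub>2 * C\<^sub>3 * N powr - t)"
      using C\<^sub>1(1) C\<^sub>2(1) by (simp add: ennreal_mult'[symmetric] mult_ac)
    finally show ?thesis .
  qed
  then show ?thesis
    using C\<^sub>1(1) C\<^sub>2(1) C\<^sub>3(1) by (intro that[of "C\<^sub>1 * C\<^sub>2 * C\<^sub>3"]) auto
qed

text \<open>Feynman parametrization, as an inequality: the range \<open>B / A \<le> r \<le> 2 * B / A\<close> alone
  contributes enough.\<close>

lemma powr_product_le_nn_integral:
  fixes A B t :: real
  assumes "0 < A" "0 < B" "0 < t"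
  shows "ennreal ((A * B) powr - t) \<le> ennreal (2 * 9 powr t) *
    (\<integral>\<^sup>+r. ennreal (if 0 < r then r powr (t - 1) * (r * A + B) powr (- 2 * t) else 0) \<partial>lborel)"
proof -
  let ?f = "\<lambda>r. if 0 < r then r powr (t - 1) * (r * A + B) powr (- 2 * t) else 0"
  \<comment> \<open>Three factors are minimised separately over the interval:
    \<open>r powr t\<close> at the left end, \<open>1 / r\<close> and
    \<open>(r * A + B) powr (- 2 * t)\<close> at the right end, where
    \<open>r * A + B = 3 * B\<close>. Times the length \<open>B / A\<close> of the interval this is
    \<open>(A * B) powr - t\<close> divided by \<open>2 * 9 powr t\<close>.\<close>
  define m where "m = (B / A) powr t * (A / (2 * B)) * (3 * B) powr (- 2 * t)"
  have m: "m \<le> ?f r" if "r \<in> {B / A .. 2 * B / A}" for r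
  proof -
    have r_bounds: "0 < B / A" "B / A \<le> r" "r \<le> 2 * B / A"
      using assms that by auto
    then have "0 < r" by linarith
    have "A / (2 * B) \<le> 1 / r" "r * A + B \<le> 3 * B"
      using r_bounds(3) \<open>0 < r\<close> assms by (auto simp: field_simps)
    moreover have "(B / A) powr t \<le> r powr t"
      using assms r_bounds by (intro powr_mono2) auto
    moreover have "(3 * B) powr (- 2 * t) \<le> (r * A + B) powr (- 2 * t)"
      using assms \<open>0 < r\<close> calculation(2) by (intro powr_mono2') (auto intro: add_pos_pos)
    ultimately have "m \<le> r powr t * (1 / r) * (r * A + B) powr (- 2 * t)"
      unfolding m_def using assms \<open>0 < r\<close> by (intro mult_mono) auto
    then show ?thesis
      using \<open>0 < r\<close> by (simp add: powr_diff)
  qed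
  have "B powr t * B powr (- 2 * t) = B powr - t"
    by (subst powr_add[symmetric]) simp
  moreover have "(3::real) powr (- 2 * t) = 9 powr - t"
    by (simp add: powr_powr[of 3 2 "- t", simplified, symmetric])
  ultimately have "2 * 9 powr t * (m * (B / A)) = (A * B) powr - t"
    using assms
    by (simp add: m_def powr_divide powr_mult powr_minus field_simps)
  then have "ennreal ((A * B) powr - t) = ennreal (2 * 9 powr t) * (ennreal m * ennreal (B / A))"
    using assms by (simp add: m_def flip: ennreal_mult')
  also have "ennreal m * ennreal (B / A) = (\<integral>\<^sup>+r. ennreal m * indicator {B / A .. 2 * B / A} r \<partial>lborel)"
    using assms by (subst nn_integral_cmult_indicator) (auto simp: field_simps)
  also have "\<dots> \<le> (\<integral>\<^sup>+r. ennreal (?f r) \<partial>lborel)"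
  proof (rule nn_integral_mono)
    fix r
    show "ennreal m * indicator {B / A .. 2 * B / A} r \<le> ennreal (?f r)"
      using ennreal_leI[OF m, of r] by (simp only: zero_le mult_1_right mult_zero_right split: split_indicator) blast
  qed
  finally show ?thesis
    by (simp add: mult_left_mono)
qed

section \<open>The upper half-space\<close>

text \<open>Over the common denominator \<open>2 * height P * height Q\<close>, the leading 1 in the
  formula for \<open>cosh d\<close> cancels the cross term of the heights in the squared norm; this
  is the numerator that remains.\<close>

definition cosh_num :: "point \<Rightarrow> point \<Rightarrow> real"
  where "cosh_num P Q =
    (fst P - fst Q)\<^sup>2 + (fst (snd P) - fst (snd Q))\<^sup>2 + (height P)\<^sup>2 + (height Q)\<^sup>2"

text \<open>The function \<open>q = 1 / cosh d\<close> of the overview, as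
  \<open>cosh_hyp_dist\<close> confirms. In this form the integrals involve only quotients of
  polynomials and no \<open>arcosh\<close>.\<close>

definition sech_dist :: "point \<Rightarrow> point \<Rightarrow> real"
  where "sech_dist P Q = 2 * height P * height Q / cosh_num P Q"

lemma cosh_num_pos: "P \<in> hyp_space \<Longrightarrow> 0 < cosh_num P Q"
  unfolding cosh_num_def hyp_space_def by (intro add_pos_nonneg[OF add_nonneg_pos]) auto

lemma sech_dist_pos: "P \<in> hyp_space \<Longrightarrow> Q \<in> hyp_space \<Longrightarrow> 0 < sech_dist P Q"
  using cosh_num_pos[of P Q] by (simp add: sech_dist_def hyp_space_def)

lemma sech_dist_commute: "sech_dist P Q = sech_dist Q P"
  by (simp add: sech_dist_def cosh_num_def power2_commute add_ac mult_ac)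

lemma measurable_coordinates [measurable]:
  "(fst :: point \<Rightarrow> real) \<in> borel_measurable borel"
  "(\<lambda>P :: point. fst (snd P)) \<in> borel_measurable borel"
  "height \<in> borel_measurable borel"
  unfolding height_def borel_prod[symmetric] by measurable

lemma hyp_space_measurable [measurable]: "hyp_space \<in> sets borel"
  unfolding hyp_space_def by measurable

lemma space_hyp_volume [simp]: "space hyp_volume = hyp_space"
  by (simp add: hyp_volume_def space_restrict_space)

text \<open>\<open>hyp_volume\<close> lives on a subspace. Viewing its points in the ambient Borel
  space makes the measurability rules for \<open>sech_dist\<close>, which expect Borel measurable
  arguments, applicable to it.\<close>

lemma measurable_ident_hyp_volume [measurable (raw)]: "(\<lambda>x. x) \<in> borel_measurable hyp_volume"
  by (simp add: hyp_volume_def measurable_restrict_space1)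

text \<open>Extending the density by 0 moves the integral to \<open>lborel\<close> on the whole
  space, where Fubini and the scaling integrals are available.\<close>

lemma nn_integral_hyp_volume:
  assumes [measurable]: "f \<in> borel_measurable borel"
  shows "(\<integral>\<^sup>+x. f x \<partial>hyp_volume)
    = (\<integral>\<^sup>+x. ennreal (if 0 < height x then 1 / height x ^ 3 else 0) * f x \<partial>lborel)"
proof -
  have "(\<integral>\<^sup>+x. f x \<partial>hyp_volume)
      = (\<integral>\<^sup>+x. ennreal (1 / height x ^ 3) * f x \<partial>restrict_space lborel hyp_space)"
    unfolding hyp_volume_def
    by (subst nn_integral_density) (auto intro!: measurable_restrict_space1)
  also have "\<dots> = (\<integral>\<^sup>+x. ennreal (1 / height x ^ 3) * f x * indicator hyp_space x \<partial>lborel)"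
    by (subst nn_integral_restrict_space) auto
  also have "\<dots> = (\<integral>\<^sup>+x. ennreal (if 0 < height x then 1 / height x ^ 3 else 0) * f x \<partial>lborel)"
    by (intro nn_integral_cong) (auto simp: hyp_space_def split: split_indicator)
  finally show ?thesis .
qed

lemma measurable_cosh_num [measurable (raw)]:
  assumes [measurable]: "f \<in> borel_measurable M" "g \<in> borel_measurable M"
  shows "(\<lambda>x. cosh_num (f x) (g x)) \<in> borel_measurable M"
  unfolding cosh_num_def by measurable

lemma measurable_sech_dist [measurable (raw)]:
  assumes [measurable]: "f \<in> borel_measurable M" "g \<in> borel_measurable M"
  shows "(\<lambda>x. sech_dist (f x) (g x)) \<in> borel_measurable M"
  unfolding sech_dist_def by measurable

text \<open>Completing the square centres the Feynman combination at a weighted mean of the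
  horizontal positions of \<open>P\<close> and \<open>Q\<close>, and \<open>N\<close> is the
  remainder. Of the two lower bounds on \<open>N\<close>, the first carries the decay in the
  distance of \<open>P\<close> and \<open>Q\<close>; the second has only the square root of the
  weight \<open>r / (1 + r)\<^sup>2\<close>, and this gain makes the later integral over
  \<open>r\<close> converge.\<close>

lemma cosh_num_combination:
  assumes "0 < r" "P \<in> hyp_space" "Q \<in> hyp_space"
  obtains c d N where
    "\<And>x. r * cosh_num x P + cosh_num x Q
      = (1 + r) * ((fst x - c)\<^sup>2 + (fst (snd x) - d)\<^sup>2 + (height x)\<^sup>2 + N)"
    "r / (1 + r)\<^sup>2 * cosh_num P Q \<le> N"
    "sqrt r / (1 + r) * (2 * height P * height Q) \<le> N"
proof -
  obtain p1 p2 p3 q1 q2 q3 where P: "P = (p1, p2, p3)" and Q: "Q = (q1, q2, q3)"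
    by (metis prod_cases3)
  have pos: "0 < p3" "0 < q3"
    using assms by (auto simp: P Q hyp_space_def height_def)
  define c d where "c = (r * p1 + q1) / (1 + r)" and "d = (r * p2 + q2) / (1 + r)"
  define D where "D = (p1 - q1)\<^sup>2 + (p2 - q2)\<^sup>2"
  define N where "N = (r * p3\<^sup>2 + q3\<^sup>2) / (1 + r) + r / (1 + r)\<^sup>2 * D"
  \<comment> \<open>A weighted sum of squared deviations is the squared deviation from the weighted
    mean plus the spread of the two points.\<close>
  have square: "r * (u - a)\<^sup>2 + (u - b)\<^sup>2 = (1 + r) * ((u - (r * a + b) / (1 + r))\<^sup>2 + r / (1 + r)\<^sup>2 * (a - b)\<^sup>2)"
    for a b u :: real
  proof -
    have "(1 + r) * (r * (u - a)\<^sup>2 + (u - b)\<^sup>2) = ((1 + r) * u - (r * a + b))\<^sup>2 + r * (a - b)\<^sup>2"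
      by (simp add: power2_eq_square algebra_simps)
    moreover define s where "s = 1 + r"
    ultimately have "s * (r * (u - a)\<^sup>2 + (u - b)\<^sup>2) = (s * u - (r * a + b))\<^sup>2 + r * (a - b)\<^sup>2"
      by simp
    moreover have "s \<noteq> 0"
      using assms by (simp add: s_def)
    moreover from this have "u - (r * a + b) / s = (s * u - (r * a + b)) / s"
      by (simp add: field_simps)
    ultimately show ?thesis
      unfolding s_def[symmetric] by (simp add: power_divide power2_eq_square[of s] field_simps)
  qed
  have "r * cosh_num x P + cosh_num x Q
      = (1 + r) * ((fst x - c)\<^sup>2 + (fst (snd x) - d)\<^sup>2 + (height x)\<^sup>2 + N)" for x
  proof -
    have "(1 + r) * ((r * p3\<^sup>2 + q3\<^sup>2) / (1 + r)) = r * p3\<^sup>2 + q3\<^sup>2"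
      using assms by simp
    then show ?thesis
      using square[of "fst x" p1 q1] square[of "fst (snd x)" p2 q2]
      unfolding c_def[symmetric] d_def[symmetric]
      by (simp add: cosh_num_def P Q height_def N_def D_def algebra_simps)
  qed
  moreover have "r / (1 + r)\<^sup>2 * cosh_num P Q \<le> N"
  proof -
    have "r / (1 + r)\<^sup>2 * (p3\<^sup>2 + q3\<^sup>2) = (r * p3\<^sup>2 + r * q3\<^sup>2) / (1 + r)\<^sup>2"
      by (simp add: field_simps)
    also have "\<dots> \<le> ((1 + r) * (r * p3\<^sup>2 + q3\<^sup>2)) / (1 + r)\<^sup>2"
      using assms by (intro divide_right_mono) (auto simp: algebra_simps)
    also have "\<dots> = (r * p3\<^sup>2 + q3\<^sup>2) / (1 + r)"
      using assms by (simp add: power2_eq_square)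
    finally show ?thesis
      by (simp add: cosh_num_def P Q height_def N_def D_def algebra_simps)
  qed
  moreover have "sqrt r / (1 + r) * (2 * height P * height Q) \<le> N"
  proof -
    \<comment> \<open>AM-GM for \<open>r * p3\<^sup>2\<close> and \<open>q3\<^sup>2\<close>; the
      horizontal part of \<open>N\<close> is nonnegative and is dropped.\<close>
    have "0 \<le> (sqrt r * p3 - q3)\<^sup>2"
      by simp
    then have "sqrt r * (2 * p3 * q3) \<le> r * p3\<^sup>2 + q3\<^sup>2"
      using assms by (simp add: power2_diff power_mult_distrib algebra_simps)
    then have "sqrt r / (1 + r) * (2 * p3 * q3) \<le> (r * p3\<^sup>2 + q3\<^sup>2) / (1 + r)"
      using assms by (simp add: divide_right_mono)
    also have "\<dots> \<le> N"
      using assms by (simp add: N_def D_def)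
    finally show ?thesis
      by (simp add: P Q height_def)
  qed
  ultimately show ?thesis
    by (rule that)
qed

section \<open>Two-point and three-point integrals\<close>

text \<open>Split the exponent \<open>t\<close> into \<open>t - \<epsilon>\<close> and
  \<open>\<epsilon>\<close> and apply one lower bound on \<open>N\<close> to each factor. The
  intended values are \<open>w = r / (1 + r)\<^sup>2\<close>, \<open>S = cosh_num P Q\<close> and
  \<open>m = 2 * height P * height Q\<close>, for which \<open>m / S\<close> is
  \<open>sech_dist P Q\<close>.\<close>

lemma powr_le_interpolation:
  fixes w m S N \<epsilon> t :: real
  assumes "0 < w" "0 < m" "0 < S" "0 \<le> \<epsilon>" "\<epsilon> \<le> t" "w * S \<le> N" "sqrt w * m \<le> N"
  shows "N powr - t \<le> w powr (\<epsilon>/2 - t) * m powr - t * (m / S) powr (t - \<epsilon>)"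
proof -
  have "N powr - t = N powr - (t - \<epsilon>) * N powr - \<epsilon>"
    by (subst powr_add[symmetric]) simp
  also have "\<dots> \<le> (w * S) powr - (t - \<epsilon>) * (sqrt w * m) powr - \<epsilon>"
    using assms by (intro mult_mono powr_mono2') auto
  also have "\<dots> = (w powr (\<epsilon> - t) * (sqrt w) powr - \<epsilon>) * (S powr (\<epsilon> - t) * m powr - \<epsilon>)"
    using assms by (simp add: powr_mult)
  also have "(sqrt w) powr - \<epsilon> = w powr - (\<epsilon>/2)"
    using assms by (simp add: powr_half_sqrt[symmetric] powr_powr)
  also have "w powr (\<epsilon> - t) * w powr - (\<epsilon>/2) = w powr (\<epsilon>/2 - t)"
    by (subst powr_add[symmetric]) (simp add: field_simps)
  also have "S powr (\<epsilon> - t) * m powr - \<epsilon> = m powr - t * (m / S) powr (t - \<epsilon>)"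
    using assms by (simp add: powr_divide powr_diff powr_minus field_simps)
  finally show ?thesis
    by (simp add: mult_ac)
qed

text \<open>With \<open>\<epsilon> = 0\<close> the integrand left over in the Feynman variable would
  be \<open>1 / r\<close>, which diverges logarithmically at both ends. Giving up an arbitrarily
  small part of the decay restores convergence; giving up all of it, \<open>\<epsilon> = t\<close>,
  leaves a bound uniform in \<open>P\<close> and \<open>Q\<close>.\<close>

lemma two_point_integral:
  assumes "1 < t" "0 < \<epsilon>" "\<epsilon> \<le> t"
  obtains C where "0 \<le> C"
    "\<And>P Q. P \<in> hyp_space \<Longrightarrow> Q \<in> hyp_space \<Longrightarrow>
      (\<integral>\<^sup>+x. ennreal ((sech_dist x P * sech_dist x Q) powr t) \<partial>hyp_volume)
        \<le> ennreal (C * sech_dist P Q powr (t - \<epsilon>))"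
proof -
  obtain C\<^sub>1 where C\<^sub>1: "0 \<le> C\<^sub>1"
    "\<And>c d N. 0 < N \<Longrightarrow>
      (\<integral>\<^sup>+(x, y, z). ennreal (if 0 < z
          then z powr (2 * t - 3) * ((x - c)\<^sup>2 + (y - d)\<^sup>2 + z\<^sup>2 + N) powr (- 2 * t) else 0) \<partial>lborel)
        = ennreal (C\<^sub>1 * N powr - t)"
    using nn_integral_half_space_powr[OF assms(1)] by blast
  \<comment> \<open>What is left in \<open>r\<close> after the integration over \<open>x\<close>:
    the product of \<open>r powr (t - 1)\<close>, \<open>(1 + r) powr (- 2 * t)\<close> and
    \<open>w powr (\<epsilon>/2 - t)\<close> with \<open>w = r / (1 + r)\<^sup>2\<close>.\<close>
  define I where "I = (\<lambda>r::real. if 0 < r then r powr (\<epsilon>/2 - 1) * (1 + r) powr - \<epsilon> else 0)"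
  have [measurable]: "I \<in> borel_measurable borel"
    unfolding I_def by measurable
  have "(\<integral>\<^sup>+r. ennreal (I r) \<partial>lborel) < \<infinity>"
  proof (rule nn_integral_powr_comparison[of "\<epsilon>/2" "\<epsilon>/2"])
    fix r :: real assume r: "0 < r" "r \<le> 1"
    have "(1 + r) powr - \<epsilon> \<le> 1 powr - \<epsilon>"
      using assms r by (intro powr_mono2') auto
    then show "I r \<le> r powr (\<epsilon>/2 - 1)"
      using r by (simp add: I_def mult_left_le)
  next
    fix r :: real assume r: "1 \<le> r"
    have "(1 + r) powr - \<epsilon> \<le> r powr - \<epsilon>"
      using assms r by (intro powr_mono2') auto
    then have "I r \<le> r powr (\<epsilon>/2 - 1) * r powr - \<epsilon>"
      using r by (simp add: I_def mult_left_mono)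
    also have "\<dots> = r powr (- (\<epsilon>/2) - 1)"
      by (subst powr_add[symmetric], rule arg_cong[where f = "(powr) r"]) simp
    finally show "I r \<le> r powr (- (\<epsilon>/2) - 1)" .
  qed (use assms in \<open>auto simp: I_def\<close>)
  then obtain C\<^sub>2 where C\<^sub>2: "0 \<le> C\<^sub>2" "(\<integral>\<^sup>+r. ennreal (I r) \<partial>lborel) = ennreal C\<^sub>2"
    by (cases "\<integral>\<^sup>+r. ennreal (I r) \<partial>lborel" rule: ennreal_cases) auto
  define K where "K = 2 * 9 powr t"
  have "(\<integral>\<^sup>+x. ennreal ((sech_dist x P * sech_dist x Q) powr t) \<partial>hyp_volume)
      \<le> ennreal (K * C\<^sub>1 * 2 powr t * C\<^sub>2 * sech_dist P Q powr (t - \<epsilon>))"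
    if P: "P \<in> hyp_space" and Q: "Q \<in> hyp_space" for P Q
  proof -
    define m where "m = 2 * height P * height Q"
    have heights: "0 < height P" "0 < height Q"
      using P Q by (auto simp: hyp_space_def)
    then have "0 < m"
      by (simp add: m_def)
    \<comment> \<open>The product of the two factors \<open>sech_dist\<close> is
      \<open>2 * m * (height x)\<^sup>2 / (A * B)\<close>, where \<open>A\<close> and
      \<open>B\<close> are the values of \<open>cosh_num\<close> at \<open>x\<close>.
      \<open>W\<close> collects the numerator to the power \<open>t\<close> and the volume density;
      \<open>F\<close> is the Feynman integrand for \<open>(A * B) powr - t\<close>.\<close>
    define W where "W = (\<lambda>x. if 0 < height x then (2 * m) powr t * height x powr (2 * t - 3) else 0)"
    define F where "F = (\<lambda>r x. if 0 < r then r powr (t - 1) * (r * cosh_num x P + cosh_num x Q) powr (- 2 * t) else 0)"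
    have [measurable]: "W \<in> borel_measurable borel"
      unfolding W_def by measurable
    have [measurable]: "(\<lambda>p. F (snd p) (fst p)) \<in> borel_measurable (borel \<Otimes>\<^sub>M borel)"
      unfolding F_def by measurable
    have [measurable]: "(\<lambda>p. F (fst p) (snd p)) \<in> borel_measurable (borel \<Otimes>\<^sub>M borel)"
      unfolding F_def by measurable
    have [measurable]: "(\<lambda>r. F r x) \<in> borel_measurable borel" for x
      unfolding F_def by measurable
    have [simp]: "0 \<le> W x" for x
      by (simp add: W_def)
    have pointwise: "ennreal (if 0 < height x then 1 / height x ^ 3 else 0) *
        ennreal ((sech_dist x P * sech_dist x Q) powr t)
        \<le> ennreal K * (\<integral>\<^sup>+r. ennreal (W x * F r x) \<partial>lborel)" for x
    proof (cases "0 < height x")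
      case True
      then have x: "x \<in> hyp_space"
        by (simp add: hyp_space_def)
      define z A B where "z = height x" and "A = cosh_num x P" and "B = cosh_num x Q"
      have "0 < z" "0 < A" "0 < B"
        using x True cosh_num_pos by (auto simp: z_def A_def B_def)
      have "sech_dist x P * sech_dist x Q = (2 * m) * (z powr 2 * (1 / (A * B)))"
        using \<open>0 < z\<close> by (simp add: sech_dist_def m_def z_def[symmetric] A_def B_def power2_eq_square)
      then have "(sech_dist x P * sech_dist x Q) powr t = (2 * m) powr t * (z powr (2 * t) * (1 / (A * B)) powr t)"
        using \<open>0 < m\<close> \<open>0 < A\<close> \<open>0 < B\<close> by (simp only: powr_mult powr_powr)
      also have "(1 / (A * B)) powr t = (A * B) powr - t"
        using \<open>0 < A\<close> \<open>0 < B\<close> by (simp add: powr_divide powr_minus_divide)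
      finally have "1 / z ^ 3 * (sech_dist x P * sech_dist x Q) powr t = W x * (A * B) powr - t"
        using True \<open>0 < z\<close> by (simp add: W_def z_def[symmetric] powr_diff)
      then have "ennreal (if 0 < height x then 1 / height x ^ 3 else 0) *
          ennreal ((sech_dist x P * sech_dist x Q) powr t) = ennreal (W x) * ennreal ((A * B) powr - t)"
        using True by (simp add: z_def flip: ennreal_mult')
      also have "\<dots> \<le> ennreal (W x) * (ennreal K * (\<integral>\<^sup>+r. ennreal (F r x) \<partial>lborel))"
        using powr_product_le_nn_integral[OF \<open>0 < A\<close> \<open>0 < B\<close>, of t] assms
        unfolding K_def F_def A_def B_def by (intro mult_left_mono) auto
      also have "\<dots> = ennreal K * (\<integral>\<^sup>+r. ennreal (W x) * ennreal (F r x) \<partial>lborel)"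
        by (subst nn_integral_cmult) (auto simp: mult_ac)
      finally show ?thesis
        by (simp add: ennreal_mult')
    qed simp
    have slice: "(\<integral>\<^sup>+x. ennreal (W x * F r x) \<partial>lborel)
        \<le> ennreal (C\<^sub>1 * 2 powr t * sech_dist P Q powr (t - \<epsilon>)) * ennreal (I r)" for r
    proof (cases "0 < r")
      case True
      then obtain c d N where N:
        "\<And>x. r * cosh_num x P + cosh_num x Q
          = (1 + r) * ((fst x - c)\<^sup>2 + (fst (snd x) - d)\<^sup>2 + (height x)\<^sup>2 + N)"
        "r / (1 + r)\<^sup>2 * cosh_num P Q \<le> N"
        "sqrt r / (1 + r) * (2 * height P * height Q) \<le> N"
        using cosh_num_combination[OF _ P Q] by blast
      define w where "w = r / (1 + r)\<^sup>2"
      have "0 < w" and sqrt_w: "sqrt w = sqrt r / (1 + r)"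
        using True by (auto simp: w_def real_sqrt_divide)
      have "0 < N"
        using N(3) heights True by (auto elim!: less_le_trans[rotated])
      let ?h = "\<lambda>x::point. if 0 < height x then height x powr (2 * t - 3) *
          ((fst x - c)\<^sup>2 + (fst (snd x) - d)\<^sup>2 + (height x)\<^sup>2 + N) powr (- 2 * t) else 0"
      define L where "L = (2 * m) powr t * r powr (t - 1) * (1 + r) powr (- 2 * t)"
      have "0 \<le> L"
        by (simp add: L_def)
      have "W x * F r x = L * ?h x" for x
        using True \<open>0 < N\<close> by (simp add: W_def F_def L_def N(1) powr_mult mult_ac)
      then have "(\<integral>\<^sup>+x. ennreal (W x * F r x) \<partial>lborel) = (\<integral>\<^sup>+x. ennreal L * ennreal (?h x) \<partial>lborel)"
        using \<open>0 \<le> L\<close> by (simp only: ennreal_mult')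
      also have "\<dots> = ennreal L * (\<integral>\<^sup>+x. ennreal (?h x) \<partial>lborel)"
        by (rule nn_integral_cmult) measurable
      also have "(\<integral>\<^sup>+x. ennreal (?h x) \<partial>lborel) = ennreal (C\<^sub>1 * N powr - t)"
        using C\<^sub>1(2)[OF \<open>0 < N\<close>, of c d] unfolding case_prod_beta height_def .
      also have "ennreal L * \<dots> = ennreal (L * (C\<^sub>1 * N powr - t))"
        using \<open>0 \<le> L\<close> by (simp add: ennreal_mult')
      also have "\<dots> \<le> ennreal (L * (C\<^sub>1 * (w powr (\<epsilon>/2 - t) * m powr - t * (m / cosh_num P Q) powr (t - \<epsilon>))))"
        using assms \<open>0 < w\<close> \<open>0 < m\<close> \<open>0 \<le> L\<close> C\<^sub>1(1) N(2,3) cosh_num_pos[OF P, of Q]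
        by (intro ennreal_leI mult_left_mono powr_le_interpolation) (auto simp: w_def m_def sqrt_w[unfolded w_def])
      also have "L * (C\<^sub>1 * (w powr (\<epsilon>/2 - t) * m powr - t * (m / cosh_num P Q) powr (t - \<epsilon>)))
          = C\<^sub>1 * ((2 * m) powr t * m powr - t) * (m / cosh_num P Q) powr (t - \<epsilon>) *
            (r powr (t - 1) * (1 + r) powr (- 2 * t) * w powr (\<epsilon>/2 - t))"
        by (simp add: L_def mult_ac)
      also have "(2 * m) powr t * m powr - t = 2 powr t"
        using \<open>0 < m\<close> by (simp add: powr_mult powr_minus)
      also have "m / cosh_num P Q = sech_dist P Q"
        by (simp add: m_def sech_dist_def)
      also have "w powr (\<epsilon>/2 - t) = r powr (\<epsilon>/2 - t) * (1 + r) powr (2 * t - \<epsilon>)"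
      proof -
        have "w = r * (1 + r) powr - 2"
          using True by (simp add: w_def powr_minus_divide)
        then show ?thesis
          using True by (simp add: powr_mult powr_powr algebra_simps)
      qed
      also have "r powr (t - 1) * (1 + r) powr (- 2 * t) * (r powr (\<epsilon>/2 - t) * (1 + r) powr (2 * t - \<epsilon>))
          = (r powr (t - 1) * r powr (\<epsilon>/2 - t)) * ((1 + r) powr (- 2 * t) * (1 + r) powr (2 * t - \<epsilon>))"
        by (simp add: mult_ac)
      also have "r powr (t - 1) * r powr (\<epsilon>/2 - t) = r powr (\<epsilon>/2 - 1)"
        by (subst powr_add[symmetric]) simp
      also have "(1 + r) powr (- 2 * t) * (1 + r) powr (2 * t - \<epsilon>) = (1 + r) powr - \<epsilon>"
        by (subst powr_add[symmetric]) simp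
      also have "r powr (\<epsilon>/2 - 1) * (1 + r) powr - \<epsilon> = I r"
        using True by (simp add: I_def)
      finally show ?thesis
        using C\<^sub>1(1) by (simp add: ennreal_mult'[symmetric])
    qed (simp add: F_def)
    have "(\<integral>\<^sup>+x. ennreal ((sech_dist x P * sech_dist x Q) powr t) \<partial>hyp_volume)
        = (\<integral>\<^sup>+x. ennreal (if 0 < height x then 1 / height x ^ 3 else 0) *
            ennreal ((sech_dist x P * sech_dist x Q) powr t) \<partial>lborel)"
      by (subst nn_integral_hyp_volume) auto
    also have "\<dots> \<le> (\<integral>\<^sup>+x. ennreal K * (\<integral>\<^sup>+r. ennreal (W x * F r x) \<partial>lborel) \<partial>lborel)"
      by (intro nn_integral_mono pointwise)
    also have "\<dots> = ennreal K * (\<integral>\<^sup>+x. (\<integral>\<^sup>+r. ennreal (W x * F r x) \<partial>lborel) \<partial>lborel)"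
      by (rule nn_integral_cmult) measurable
    \<comment> \<open>After the exchange \<open>r\<close> is fixed in the inner integral, whose
      denominator is then a single centred quadratic form.\<close>
    also have "(\<integral>\<^sup>+x. (\<integral>\<^sup>+r. ennreal (W x * F r x) \<partial>lborel) \<partial>lborel)
        = (\<integral>\<^sup>+r. (\<integral>\<^sup>+x. ennreal (W x * F r x) \<partial>lborel) \<partial>lborel)"
      by (rule lborel_pair.Fubini') measurable
    also have "\<dots> \<le> (\<integral>\<^sup>+r. ennreal (C\<^sub>1 * 2 powr t * sech_dist P Q powr (t - \<epsilon>)) * ennreal (I r) \<partial>lborel)"
      by (intro nn_integral_mono slice)
    also have "\<dots> = ennreal (C\<^sub>1 * 2 powr t * sech_dist P Q powr (t - \<epsilon>)) * ennreal C\<^sub>2"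
      by (subst nn_integral_cmult) (auto simp: C\<^sub>2)
    also have "ennreal K * \<dots> = ennreal (K * C\<^sub>1 * 2 powr t * C\<^sub>2 * sech_dist P Q powr (t - \<epsilon>))"
      using C\<^sub>1(1) C\<^sub>2(1) by (simp add: K_def mult_ac flip: ennreal_mult')
    finally show ?thesis
      by (simp add: mult_left_mono)
  qed
  then show ?thesis
    using C\<^sub>1(1) C\<^sub>2(1) by (intro that[of "K * C\<^sub>1 * 2 powr t * C\<^sub>2"]) (auto simp: K_def)
qed

lemma arith_geom_mean_3:
  fixes a b c :: real
  assumes "0 \<le> a" "0 \<le> b" "0 \<le> c"
  shows "(a * b * c) powr (1/3) \<le> (a + b + c) / 3"
proof -
  have "(\<Prod>i<3. [a, b, c] ! i) powr (1 / card {..<3::nat}) \<le> (\<Sum>i<3. [a, b, c] ! i / card {..<3::nat})"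
    using assms by (intro arith_geom_mean) (auto simp: less_Suc_eq numeral_3_eq_3)
  then show ?thesis
    by (simp add: numeral_3_eq_3 field_simps)
qed

text \<open>Hoelder's inequality for three factors, replaced by AM-GM with the weights that the two-point
  bounds dictate.\<close>

lemma three_point_integral:
  assumes "2/3 < s" "0 < \<epsilon>" "\<epsilon> \<le> 3 * s / 2"
  obtains C where "0 \<le> C"
    "\<And>P Q R. P \<in> hyp_space \<Longrightarrow> Q \<in> hyp_space \<Longrightarrow> R \<in> hyp_space \<Longrightarrow>
      (\<integral>\<^sup>+x. ennreal ((sech_dist x P * sech_dist x Q * sech_dist x R) powr s) \<partial>hyp_volume)
        \<le> ennreal (C * (sech_dist P Q * sech_dist Q R * sech_dist R P) powr (s/2 - \<epsilon>/3))"
proof -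
  \<comment> \<open>Each of the three points occurs in two of the three pairs, so the geometric mean
    of the two-point integrands has exponent \<open>2 * t / 3\<close>, which has to equal
    \<open>s\<close>. The condition \<open>1 < t\<close> becomes \<open>2/3 < s\<close>.\<close>
  define t where "t = 3 * s / 2"
  obtain C where C: "0 \<le> C"
    "\<And>P Q. P \<in> hyp_space \<Longrightarrow> Q \<in> hyp_space \<Longrightarrow>
      (\<integral>\<^sup>+x. ennreal ((sech_dist x P * sech_dist x Q) powr t) \<partial>hyp_volume)
        \<le> ennreal (C * sech_dist P Q powr (t - \<epsilon>))"
    using two_point_integral[of t \<epsilon>] assms by (auto simp: t_def)
  have "(\<integral>\<^sup>+x. ennreal ((sech_dist x P * sech_dist x Q * sech_dist x R) powr s) \<partial>hyp_volume)
        \<le> ennreal (C * (sech_dist P Q * sech_dist Q R * sech_dist R P) powr (s/2 - \<epsilon>/3))"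
    if P: "P \<in> hyp_space" and Q: "Q \<in> hyp_space" and R: "R \<in> hyp_space" for P Q R
  proof -
    define f where "f = (\<lambda>P Q x. (sech_dist x P * sech_dist x Q) powr t)"
    define b where "b = (\<lambda>P Q. sech_dist P Q powr (t - \<epsilon>))"
    \<comment> \<open>The geometric mean of the three two-point bounds. Each integrand is divided by
      its own bound before AM-GM, so that all three contribute the same \<open>C * g / 3\<close>;
      without this normalisation the result would be the arithmetic mean of the bounds.\<close>
    define g where "g = (b P Q * b Q R * b R P) powr (1/3)"
    have sech: "0 < sech_dist P Q" "0 < sech_dist Q R" "0 < sech_dist R P"
      using P Q R by (auto intro: sech_dist_pos)
    then have pos: "0 < b P Q" "0 < b Q R" "0 < b R P"
      by (auto simp: b_def)
    then have "0 < g"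
      by (simp add: g_def)
    have g: "g = (sech_dist P Q * sech_dist Q R * sech_dist R P) powr (s/2 - \<epsilon>/3)"
      using sech by (simp add: g_def b_def powr_mult powr_powr t_def field_simps)
    have [measurable]: "f P Q \<in> borel_measurable hyp_volume" for P Q
      unfolding f_def by measurable
    have f_nonneg: "0 \<le> f P Q x" for P Q x
      by (simp add: f_def)
    have bound: "(\<integral>\<^sup>+x. ennreal (g / (3 * b P Q)) * ennreal (f P Q x) \<partial>hyp_volume) \<le> ennreal (C * g / 3)"
      if "P \<in> hyp_space" "Q \<in> hyp_space" "0 < b P Q" for P Q
    proof -
      have "(\<integral>\<^sup>+x. ennreal (g / (3 * b P Q)) * ennreal (f P Q x) \<partial>hyp_volume)
          = ennreal (g / (3 * b P Q)) * (\<integral>\<^sup>+x. ennreal (f P Q x) \<partial>hyp_volume)"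
        by (rule nn_integral_cmult) measurable
      also have "\<dots> \<le> ennreal (g / (3 * b P Q)) * ennreal (C * b P Q)"
        using C(2)[OF that(1,2)] by (intro mult_left_mono) (auto simp: f_def b_def)
      also have "\<dots> = ennreal (C * g / 3)"
        using that(3) \<open>0 < g\<close> by (subst ennreal_mult'[symmetric]) (simp_all add: mult_ac)
      finally show ?thesis .
    qed
    have pointwise: "ennreal ((sech_dist x P * sech_dist x Q * sech_dist x R) powr s)
        \<le> ennreal (g / (3 * b P Q)) * ennreal (f P Q x) + ennreal (g / (3 * b Q R)) * ennreal (f Q R x)
          + ennreal (g / (3 * b R P)) * ennreal (f R P x)" (is "_ \<le> ?rhs")
      if x: "x \<in> hyp_space" for x
    proof -
      define u v w where "u = sech_dist x P" and "v = sech_dist x Q" and "w = sech_dist x R"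
      have uvw: "0 < u" "0 < v" "0 < w"
        using x P Q R by (auto simp: u_def v_def w_def intro: sech_dist_pos)
      have "(f P Q x * f Q R x * f R P x) powr (1/3) = (u * v * w) powr s"
        using uvw by (simp add: f_def u_def[symmetric] v_def[symmetric] w_def[symmetric] powr_mult powr_powr t_def
            flip: powr_add)
          (simp add: powr_add[symmetric] field_simps)
      also have "f P Q x * f Q R x * f R P x
          = (b P Q * b Q R * b R P) * (f P Q x / b P Q * (f Q R x / b Q R) * (f R P x / b R P))"
        using pos by simp
      also have "\<dots> powr (1/3) = g * (f P Q x / b P Q * (f Q R x / b Q R) * (f R P x / b R P)) powr (1/3)"
        unfolding g_def by (rule powr_mult)
      finally have "(u * v * w) powr s
          = g * (f P Q x / b P Q * (f Q R x / b Q R) * (f R P x / b R P)) powr (1/3)"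
        by (rule sym)
      also have "\<dots> \<le> g * ((f P Q x / b P Q + f Q R x / b Q R + f R P x / b R P) / 3)"
        using pos \<open>0 < g\<close> by (intro mult_left_mono arith_geom_mean_3) (auto simp: f_def)
      also have "\<dots> = g / (3 * b P Q) * f P Q x + g / (3 * b Q R) * f Q R x + g / (3 * b R P) * f R P x"
        by (simp add: field_simps)
      finally have "ennreal ((u * v * w) powr s) \<le> ennreal \<dots>"
        by (rule ennreal_leI)
      also have "\<dots> = ?rhs"
        using pos \<open>0 < g\<close> by (simp add: f_nonneg ennreal_mult' ennreal_plus del: times_divide_eq_left)
      finally show ?thesis
        by (simp add: u_def v_def w_def)
    qed
    have "(\<integral>\<^sup>+x. ennreal ((sech_dist x P * sech_dist x Q * sech_dist x R) powr s) \<partial>hyp_volume)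
        \<le> (\<integral>\<^sup>+x. ennreal (g / (3 * b P Q)) * ennreal (f P Q x) + ennreal (g / (3 * b Q R)) * ennreal (f Q R x)
          + ennreal (g / (3 * b R P)) * ennreal (f R P x) \<partial>hyp_volume)"
      by (intro nn_integral_mono pointwise) simp
    also have "\<dots> = (\<integral>\<^sup>+x. ennreal (g / (3 * b P Q)) * ennreal (f P Q x) \<partial>hyp_volume)
        + (\<integral>\<^sup>+x. ennreal (g / (3 * b Q R)) * ennreal (f Q R x) \<partial>hyp_volume)
        + (\<integral>\<^sup>+x. ennreal (g / (3 * b R P)) * ennreal (f R P x) \<partial>hyp_volume)"
      by (subst nn_integral_add; (subst nn_integral_add)?) auto
    also have "\<dots> \<le> ennreal (C * g / 3) + ennreal (C * g / 3) + ennreal (C * g / 3)"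
      using P Q R pos by (intro add_mono bound)
    also have "\<dots> = ennreal (C * g)"
      using C(1) \<open>0 < g\<close> by (simp flip: ennreal_plus)
    finally show ?thesis
      by (simp only: g)
  qed
  with C(1) show ?thesis by (rule that)
qed

section \<open>Domination of the kernels by powers of \<open>1 / cosh d\<close>\<close>

lemma kernel_fun_le:
  assumes "0 \<le> p" "0 \<le> r" "s < 1" "0 \<le> s"
  shows "\<bar>kernel_fun p r\<bar> \<le> 4 / (1 - s) * (1 / cosh r) powr s"
proof -
  have "exp (- r) \<le> exp r"
    using assms by simp
  then have cosh_le: "cosh r \<le> exp r"
    by (simp add: cosh_def)
  consider "r = 0" | "0 < r" "p = 0" | "0 < r" "0 < p"
    using assms by linarith
  \<comment> \<open>Since \<open>\<bar>sin x\<bar> \<le> x\<close> for \<open>x \<ge> 0\<close>, the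
    kernel with label 0 dominates all others and the label disappears.\<close>
  then have "\<bar>kernel_fun p r\<bar> \<le> (if r = 0 then 1 else r / sinh r)"
  proof cases
    case 3
    have "\<bar>sin (p * r)\<bar> \<le> p * r"
      using abs_sin_x_le_abs_x[of "p * r"] 3 by simp
    then show ?thesis
      using 3 by (simp add: kernel_fun_def abs_mult field_simps)
  qed (auto simp: kernel_fun_def)
  also have "\<dots> \<le> 4 / (1 - s) * (1 / cosh r) powr s"
  \<comment> \<open>Near 0 the kernel is at most 1 and \<open>cosh r \<le> 4\<close>. Away from 0,
    \<open>sinh r\<close> is at least \<open>exp r / 4\<close>. The constant 4 serves both
    ranges.\<close>
  proof (cases "r \<le> 1")
    case True
    have "exp r \<le> 3"
      using True exp_le by (meson exp_le_cancel_iff order_trans)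
    with cosh_le have "cosh r \<le> 4"
      by linarith
    then have "1 / 4 \<le> 1 / cosh r"
      by (simp add: field_simps)
    moreover have "(1/4::real) powr 1 \<le> (1/4) powr s"
      using assms by (intro powr_mono') auto
    ultimately have "1 / 4 \<le> (1 / cosh r) powr s"
      using powr_mono2[of s "1/4" "1 / cosh r"] assms by simp
    moreover have "4 \<le> 4 / (1 - s)"
      using assms by (simp add: field_simps)
    ultimately have "4 * (1 / 4) \<le> 4 / (1 - s) * (1 / cosh r) powr s"
      using assms by (intro mult_mono) auto
    moreover have "r \<le> sinh r"
      using assms real_le_x_sinh[of r] by (simp add: sinh_def exp_minus field_simps)
    then have "(if r = 0 then 1 else r / sinh r) \<le> 1"
      using assms by simp
    ultimately show ?thesis by linarith
  next
    case False
    have "2 \<le> exp r"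
      using exp_ge_add_one_self[of r] False by linarith
    then have "2 * 1 \<le> exp r * exp r"
      using False by (intro mult_mono) auto
    then have "exp r / 4 \<le> sinh r"
      by (simp add: sinh_def exp_minus field_simps)
    \<comment> \<open>The linear factor \<open>r\<close> is paid for with the spare exponential
      decay \<open>1 - s\<close>, which explains the factor \<open>1 / (1 - s)\<close>.\<close>
    moreover have "(1 - s) * r \<le> exp ((1 - s) * r)"
      using exp_ge_add_one_self[of "(1 - s) * r"] by linarith
    then have "r \<le> exp ((1 - s) * r) / (1 - s)"
      using assms by (simp add: field_simps)
    ultimately have "r / sinh r \<le> (exp ((1 - s) * r) / (1 - s)) / (exp r / 4)"
      using False assms by (intro frac_le) auto
    also have "\<dots> = 4 / (1 - s) * (exp ((1 - s) * r) / exp r)"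
      by (simp add: field_simps)
    also have "exp ((1 - s) * r) / exp r = exp (- r) powr s"
      by (simp add: powr_def algebra_simps flip: exp_diff)
    also have "4 / (1 - s) * \<dots> \<le> 4 / (1 - s) * (1 / cosh r) powr s"
    proof -
      have "exp (- r) \<le> 1 / cosh r"
        using cosh_le by (simp add: exp_minus field_simps)
      then show ?thesis
        using assms by (intro mult_left_mono powr_mono2) auto
    qed
    finally show ?thesis
      using False by simp
  qed
  finally show ?thesis .
qed

lemma cosh_hyp_dist:
  assumes "P \<in> hyp_space" "Q \<in> hyp_space"
  shows "cosh (hyp_dist P Q) = 1 / sech_dist P Q"
proof -
  have heights: "0 < height P" "0 < height Q"
    using assms by (auto simp: hyp_space_def)
  then have "cosh (hyp_dist P Q) = 1 + (norm (P - Q))\<^sup>2 / (2 * height P * height Q)"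
    by (simp add: hyp_dist_def)
  also have "(norm (P - Q))\<^sup>2 = (fst P - fst Q)\<^sup>2 + (fst (snd P) - fst (snd Q))\<^sup>2 + (height P - height Q)\<^sup>2"
    by (simp add: norm_prod_def height_def real_norm_def)
  also have "1 + \<dots> / (2 * height P * height Q) = 1 / sech_dist P Q"
    using heights by (simp add: sech_dist_def cosh_num_def power2_diff field_simps)
  finally show ?thesis .
qed

lemma kernel_le:
  assumes "0 \<le> p" "P \<in> hyp_space" "Q \<in> hyp_space" "0 \<le> s" "s < 1"
  shows "\<bar>kernel p P Q\<bar> \<le> 4 / (1 - s) * sech_dist P Q powr s"
proof -
  have "0 < height P" "0 < height Q"
    using assms by (auto simp: hyp_space_def)
  then have "0 \<le> hyp_dist P Q"
    by (simp add: hyp_dist_def)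
  then show ?thesis
    using kernel_fun_le[OF \<open>0 \<le> p\<close> _ \<open>s < 1\<close> \<open>0 \<le> s\<close>, of "hyp_dist P Q"] assms(2,3)
    by (simp add: kernel_def cosh_hyp_dist)
qed

section \<open>The tetrahedron\<close>

lemma sigma_finite_hyp_volume: "sigma_finite_measure hyp_volume"
proof -
  interpret sigma_finite_measure "restrict_space lborel hyp_space"
    by (rule sigma_finite_measure_restrict_space) (auto intro: sigma_finite_lborel)
  show ?thesis
    unfolding hyp_volume_def
    by (subst sigma_finite_iff_density_finite) (auto intro!: measurable_restrict_space1)
qed

text \<open>Coordinates are peeled off one at a time, the first listed becoming the outermost
  integral.\<close>

lemma nn_integral_PiM_3:
  assumes "sigma_finite_measure M" and ijk: "i \<noteq> j" "i \<noteq> k" "j \<noteq> k"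
    and f: "(\<lambda>(x, y, z). f x y z) \<in> borel_measurable (M \<Otimes>\<^sub>M M \<Otimes>\<^sub>M M)"
  shows "(\<integral>\<^sup>+\<sigma>. f (\<sigma> i) (\<sigma> j) (\<sigma> k) \<partial>(\<Pi>\<^sub>M v\<in>{i, j, k}. M)) = (\<integral>\<^sup>+x. (\<integral>\<^sup>+y. (\<integral>\<^sup>+z. f x y z \<partial>M) \<partial>M) \<partial>M)"
proof -
  interpret product_sigma_finite "\<lambda>_. M"
    using assms(1) by (intro product_sigma_finite.intro)
  have f': "(\<lambda>\<sigma>. f (g \<sigma>) (h \<sigma>) (l \<sigma>)) \<in> borel_measurable N"
    if "g \<in> N \<rightarrow>\<^sub>M M" "h \<in> N \<rightarrow>\<^sub>M M" "l \<in> N \<rightarrow>\<^sub>M M" for g h l and N :: "('b \<Rightarrow> 'a) measure"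
    using measurable_compose[OF measurable_Pair[OF that(1) measurable_Pair[OF that(2,3)]] f] by simp
  have "(\<integral>\<^sup>+\<sigma>. f (\<sigma> i) (\<sigma> j) (\<sigma> k) \<partial>(\<Pi>\<^sub>M v\<in>{i, j, k}. M))
      = (\<integral>\<^sup>+x. (\<integral>\<^sup>+\<sigma>. f x (\<sigma> j) (\<sigma> k) \<partial>(\<Pi>\<^sub>M v\<in>{j, k}. M)) \<partial>M)"
    using ijk by (subst product_nn_integral_insert_rev) (auto intro!: f' measurable_component_singleton)
  also have "\<dots> = (\<integral>\<^sup>+x. (\<integral>\<^sup>+y. (\<integral>\<^sup>+\<sigma>. f x y (\<sigma> k) \<partial>(\<Pi>\<^sub>M v\<in>{k}. M)) \<partial>M) \<partial>M)"
    using ijk by (intro nn_integral_cong, subst product_nn_integral_insert_rev)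
      (auto intro!: f' measurable_component_singleton)
  also have "\<dots> = (\<integral>\<^sup>+x. (\<integral>\<^sup>+y. (\<integral>\<^sup>+z. f x y z \<partial>M) \<partial>M) \<partial>M)"
  proof (intro nn_integral_cong)
    fix x y assume "x \<in> space M" "y \<in> space M"
    then have "(\<lambda>z. (x, y, z)) \<in> M \<rightarrow>\<^sub>M M \<Otimes>\<^sub>M M \<Otimes>\<^sub>M M"
      by measurable
    from measurable_compose[OF this f] show "(\<integral>\<^sup>+\<sigma>. f x y (\<sigma> k) \<partial>(\<Pi>\<^sub>M v\<in>{k}. M)) = (\<integral>\<^sup>+z. f x y z \<partial>M)"
      by (intro product_nn_integral_singleton) simp
  qed
  finally show ?thesis .
qed

text \<open>The second power belongs to the triangle \<open>a\<close>, \<open>y\<close>,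
  \<open>z\<close> opposite \<open>x\<close>, so it is constant in the innermost integral. The
  exponents develop as \<open>1/3 + 8/9 = 11/9\<close> on that triangle and then
  \<open>8/9 + 11/9 = 19/9\<close> on its edge from \<open>z\<close> to \<open>a\<close>.\<close>

lemma tetrahedron_integral_finite:
  assumes a: "a \<in> hyp_space"
  shows "(\<integral>\<^sup>+z. (\<integral>\<^sup>+y. (\<integral>\<^sup>+x. ennreal ((sech_dist x a * sech_dist x y * sech_dist x z) powr (8/9)
      * (sech_dist y a * sech_dist y z * sech_dist z a) powr (8/9)) \<partial>hyp_volume) \<partial>hyp_volume) \<partial>hyp_volume) < \<infinity>"
proof -
  obtain C\<^sub>1 where C\<^sub>1: "0 \<le> C\<^sub>1"
    "\<And>P Q R. P \<in> hyp_space \<Longrightarrow> Q \<in> hyp_space \<Longrightarrow> R \<in> hyp_space \<Longrightarrow>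
      (\<integral>\<^sup>+x. ennreal ((sech_dist x P * sech_dist x Q * sech_dist x R) powr (8/9)) \<partial>hyp_volume)
        \<le> ennreal (C\<^sub>1 * (sech_dist P Q * sech_dist Q R * sech_dist R P) powr (1/3))"
    using three_point_integral[of "8/9" "1/3"] by auto
  obtain C\<^sub>2 where C\<^sub>2: "0 \<le> C\<^sub>2"
    "\<And>P Q. P \<in> hyp_space \<Longrightarrow> Q \<in> hyp_space \<Longrightarrow>
      (\<integral>\<^sup>+x. ennreal ((sech_dist x P * sech_dist x Q) powr (11/9)) \<partial>hyp_volume)
        \<le> ennreal (C\<^sub>2 * sech_dist P Q powr (8/9))"
    using two_point_integral[of "11/9" "1/3"] by auto
  \<comment> \<open>The last integral, of a single factor to the power 19/9, is read as a two-point
    integral with coinciding points and exponent 19/18. Taking \<open>\<epsilon> = t\<close> makes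
    its bound a constant.\<close>
  obtain C\<^sub>3 where C\<^sub>3: "0 \<le> C\<^sub>3"
    "\<And>P Q. P \<in> hyp_space \<Longrightarrow> Q \<in> hyp_space \<Longrightarrow>
      (\<integral>\<^sup>+x. ennreal ((sech_dist x P * sech_dist x Q) powr (19/18)) \<partial>hyp_volume)
        \<le> ennreal (C\<^sub>3 * sech_dist P Q powr 0)"
    using two_point_integral[of "19/18" "19/18"] by auto
  let ?S = "\<lambda>y z. sech_dist y a * sech_dist y z * sech_dist z a"
  have inner: "(\<integral>\<^sup>+x. ennreal ((sech_dist x a * sech_dist x y * sech_dist x z) powr (8/9) * ?S y z powr (8/9)) \<partial>hyp_volume)
      \<le> ennreal (C\<^sub>1 * ?S y z powr (11/9))"
    if "y \<in> hyp_space" "z \<in> hyp_space" for y z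
  proof -
    have "(\<integral>\<^sup>+x. ennreal ((sech_dist x a * sech_dist x y * sech_dist x z) powr (8/9) * ?S y z powr (8/9)) \<partial>hyp_volume)
        = (\<integral>\<^sup>+x. ennreal ((sech_dist x a * sech_dist x y * sech_dist x z) powr (8/9)) \<partial>hyp_volume) * ennreal (?S y z powr (8/9))"
      by (simp only: ennreal_mult'' powr_ge_zero) (rule nn_integral_multc, measurable)
    also have "\<dots> \<le> ennreal (C\<^sub>1 * ?S y z powr (1/3)) * ennreal (?S y z powr (8/9))"
      using C\<^sub>1(2)[OF a that] by (intro mult_right_mono) (auto simp: sech_dist_commute)
    also have "\<dots> = ennreal (C\<^sub>1 * (?S y z powr (1/3) * ?S y z powr (8/9)))"
      by (simp add: mult.assoc flip: ennreal_mult'')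
    also have "?S y z powr (1/3) * ?S y z powr (8/9) = ?S y z powr (11/9)"
      by (subst powr_add[symmetric]) simp
    finally show ?thesis .
  qed
  have middle: "(\<integral>\<^sup>+y. ennreal (C\<^sub>1 * ?S y z powr (11/9)) \<partial>hyp_volume)
      \<le> ennreal (C\<^sub>1 * C\<^sub>2) * ennreal ((sech_dist z a * sech_dist z a) powr (19/18))"
    if z: "z \<in> hyp_space" for z
  proof -
    define q where "q = sech_dist z a"
    have "0 < q"
      using a z by (simp add: q_def sech_dist_pos)
    have "(\<integral>\<^sup>+y. ennreal (C\<^sub>1 * ?S y z powr (11/9)) \<partial>hyp_volume)
        = (\<integral>\<^sup>+y. ennreal (C\<^sub>1 * q powr (11/9)) * ennreal ((sech_dist y a * sech_dist y z) powr (11/9)) \<partial>hyp_volume)"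
      using C\<^sub>1(1) unfolding q_def[symmetric]
      by (intro nn_integral_cong) (subst ennreal_mult'[symmetric], simp, subst powr_mult[of _ q], simp add: mult_ac)
    also have "\<dots> = ennreal (C\<^sub>1 * q powr (11/9)) * (\<integral>\<^sup>+y. ennreal ((sech_dist y a * sech_dist y z) powr (11/9)) \<partial>hyp_volume)"
      by (rule nn_integral_cmult) measurable
    also have "\<dots> \<le> ennreal (C\<^sub>1 * q powr (11/9)) * ennreal (C\<^sub>2 * q powr (8/9))"
      using C\<^sub>2(2)[OF a z] by (intro mult_left_mono) (auto simp: q_def sech_dist_commute)
    also have "\<dots> = ennreal (C\<^sub>1 * C\<^sub>2 * (q powr (11/9) * q powr (8/9)))"
      using C\<^sub>1(1) by (simp add: mult_ac flip: ennreal_mult')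
    also have "q powr (11/9) * q powr (8/9) = (q * q) powr (19/18)"
      using \<open>0 < q\<close> by (simp add: powr_mult flip: powr_add)
    finally show ?thesis
      using C\<^sub>1(1) C\<^sub>2(1) by (simp add: q_def ennreal_mult')
  qed
  have "(\<integral>\<^sup>+z. (\<integral>\<^sup>+y. (\<integral>\<^sup>+x. ennreal ((sech_dist x a * sech_dist x y * sech_dist x z) powr (8/9)
      * ?S y z powr (8/9)) \<partial>hyp_volume) \<partial>hyp_volume) \<partial>hyp_volume)
      \<le> (\<integral>\<^sup>+z. (\<integral>\<^sup>+y. ennreal (C\<^sub>1 * ?S y z powr (11/9)) \<partial>hyp_volume) \<partial>hyp_volume)"
    by (intro nn_integral_mono inner) auto
  also have "\<dots> \<le> (\<integral>\<^sup>+z. ennreal (C\<^sub>1 * C\<^sub>2) * ennreal ((sech_dist z a * sech_dist z a) powr (19/18)) \<partial>hyp_volume)"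
    by (intro nn_integral_mono middle) auto
  also have "\<dots> = ennreal (C\<^sub>1 * C\<^sub>2) * (\<integral>\<^sup>+z. ennreal ((sech_dist z a * sech_dist z a) powr (19/18)) \<partial>hyp_volume)"
    by (rule nn_integral_cmult) measurable
  also have "\<dots> \<le> ennreal (C\<^sub>1 * C\<^sub>2) * ennreal (C\<^sub>3 * sech_dist a a powr 0)"
    by (intro mult_left_mono C\<^sub>3(2)[OF a a]) auto
  also have "\<dots> < \<infinity>"
    by (simp add: ennreal_mult_less_top)
  finally show ?thesis .
qed

section \<open>Combinatorics of the complete graph\<close>

lemma prod_complete_graph:
  fixes f :: "'v \<Rightarrow> 'v \<Rightarrow> real"
  assumes "complete_graph {a, b, c, d} E s t" "distinct [a, b, c, d]"
    and sym: "\<And>u v. f u v = f v u"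
  shows "(\<Prod>e\<in>E. f (s e) (t e)) = f a b * f a c * f a d * f b c * f b d * f c d"
proof -
  \<comment> \<open>By symmetry \<open>f\<close> descends to unordered pairs, so the product over
    edges can be reindexed by the two-element sets of vertices.\<close>
  define g where "g = (\<lambda>U. THE r. \<exists>u v. U = {u, v} \<and> r = f u v)"
  have g: "g {u, v} = f u v" for u v
    unfolding g_def by (rule the_equality) (auto simp: doubleton_eq_iff sym)
  have pairs: "{U. U \<subseteq> {a, b, c, d} \<and> card U = 2} = {{a, b}, {a, c}, {a, d}, {b, c}, {b, d}, {c, d}}"
    (is "?L = ?R")
  proof
    show "?L \<subseteq> ?R"
    proof
      fix U assume "U \<in> ?L"
      then obtain u v where U: "U = {u, v}" and "u \<noteq> v" "u \<in> {a, b, c, d}" "v \<in> {a, b, c, d}"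
        by (auto simp: card_2_iff)
      from this(2-4) show "U \<in> ?R"
        unfolding U by (elim insertE emptyE) (simp_all add: doubleton_eq_iff)
    qed
    show "?R \<subseteq> ?L"
      using assms(2) by auto
  qed
  have "(\<Prod>e\<in>E. f (s e) (t e)) = (\<Prod>e\<in>E. g {s e, t e})"
    by (simp only: g)
  also have "\<dots> = prod g {U. U \<subseteq> {a, b, c, d} \<and> card U = 2}"
    using assms(1) unfolding complete_graph_def by (rule prod.reindex_bij_betw)
  also have "\<dots> = g {a, b} * g {a, c} * g {a, d} * g {b, c} * g {b, d} * g {c, d}"
    unfolding pairs using assms(2) by (simp add: doubleton_eq_iff mult_ac)
  finally show ?thesis
    by (simp only: g)
qed

lemma complete_graph_endpoints:
  assumes "complete_graph V E s t" "e \<in> E"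
  shows "s e \<in> V" "t e \<in> V"
  using assms bij_betwE unfolding complete_graph_def by fastforce+

lemma complete_graph_finite_connected:
  assumes "complete_graph V E s t" "finite V" "V \<noteq> {}"
  shows "finite_connected_graph V E s t"
proof -
  let ?r = "(\<lambda>e. (s e, t e)) ` E \<union> (\<lambda>e. (t e, s e)) ` E"
  have bij: "bij_betw (\<lambda>e. {s e, t e}) E {U. U \<subseteq> V \<and> card U = 2}"
    using assms(1) by (simp add: complete_graph_def)
  have "finite E"
    using bij_betw_finite[OF bij] assms(2) by simp
  moreover have "(u, v) \<in> ?r\<^sup>*" if "u \<in> V" "v \<in> V" for u v
  proof (cases "u = v")
    case False
    then have "{u, v} \<in> {U. U \<subseteq> V \<and> card U = 2}"
      using that by simp
    then obtain e where "e \<in> E" "{u, v} = {s e, t e}"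
      using bij_betw_imp_surj_on[OF bij] by (metis (no_types, lifting) imageE)
    then have "(u, v) \<in> ?r"
      by (auto simp: doubleton_eq_iff)
    then show ?thesis by (rule r_into_rtrancl)
  qed simp
  ultimately show ?thesis
    using assms complete_graph_endpoints[OF assms(1)]
    unfolding finite_connected_graph_def by (auto simp only: image_subset_iff)
qed

theorem theorem2:
  fixes V :: "'v set" and E :: "'e set" and s t :: "'e \<Rightarrow> 'v"
  assumes "complete_graph V E s t"
    and "card V = 4"
  shows "integrable_graph V E s t"
  unfolding integrable_graph_def integrable_network_def
proof (intro conjI allI impI ballI)
  have "finite V" "V \<noteq> {}"
    using assms(2) card.infinite by fastforce+
  with assms(1) show connected: "finite_connected_graph V E s t"
    by (rule complete_graph_finite_connected)
  fix p :: "'e \<Rightarrow> real" and w a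
  assume p: "\<forall>e\<in>E. 0 \<le> p e" and w: "w \<in> V" and a: "a \<in> hyp_space"
  have "card (V - {w}) = 3"
    using assms(2) w by simp
  \<comment> \<open>Listing the vertices as \<open>z\<close>, \<open>y\<close>, \<open>x\<close>
    makes \<open>x\<close> the innermost variable, as in
    \<open>tetrahedron_integral_finite\<close>.\<close>
  then obtain x y z where xyz: "V - {w} = {z, y, x}" "z \<noteq> y" "z \<noteq> x" "y \<noteq> x"
    by (metis card_3_iff)
  then have distinct: "distinct [w, x, y, z]" and V: "V = {w, x, y, z}"
    using w by auto
  let ?S = "\<lambda>Z Y X. (sech_dist X a * sech_dist X Y * sech_dist X Z) powr (8/9)
      * (sech_dist Y a * sech_dist Y Z * sech_dist Z a) powr (8/9)"
  \<comment> \<open>Each of the six edges contributes the kernel constant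
    \<open>4 / (1 - 8/9) = 36\<close>.\<close>
  have bound: "ennreal \<bar>\<Prod>e\<in>E. kernel (p e) ((\<sigma>(w := a)) (s e)) ((\<sigma>(w := a)) (t e))\<bar>
      \<le> ennreal (36 ^ 6) * ennreal (?S (\<sigma> z) (\<sigma> y) (\<sigma> x))"
    if "\<sigma> \<in> space (\<Pi>\<^sub>M v\<in>V - {w}. hyp_volume)" for \<sigma>
  proof -
    define \<tau> where "\<tau> = \<sigma>(w := a)"
    have \<tau>: "\<tau> v \<in> hyp_space" if "v \<in> V" for v
      using that \<open>\<sigma> \<in> _\<close> a by (auto simp: \<tau>_def space_PiM PiE_iff)
    have "\<bar>\<Prod>e\<in>E. kernel (p e) (\<tau> (s e)) (\<tau> (t e))\<bar>
        \<le> (\<Prod>e\<in>E. 36 * sech_dist (\<tau> (s e)) (\<tau> (t e)) powr (8/9))"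
      unfolding abs_prod
    proof (intro prod_mono conjI)
      fix e assume "e \<in> E"
      then show "\<bar>kernel (p e) (\<tau> (s e)) (\<tau> (t e))\<bar> \<le> 36 * sech_dist (\<tau> (s e)) (\<tau> (t e)) powr (8/9)"
        using kernel_le[of "p e" "\<tau> (s e)" "\<tau> (t e)" "8/9"] p \<tau> complete_graph_endpoints[OF assms(1)] by auto
    qed simp
    also have "\<dots> = 36 ^ 6 * ?S (\<sigma> z) (\<sigma> y) (\<sigma> x)"
    proof -
      have \<tau>_simps: "\<tau> w = a" "\<tau> x = \<sigma> x" "\<tau> y = \<sigma> y" "\<tau> z = \<sigma> z"
        using distinct by (auto simp: \<tau>_def)
      let ?f = "\<lambda>u v. 36 * sech_dist (\<tau> u) (\<tau> v) powr (8/9)"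
      have "?f u v = ?f v u" for u v
        by (simp only: sech_dist_commute)
      \<comment> \<open>Taking \<open>x\<close> first groups the three edges at \<open>x\<close>
        ahead of those of the opposite triangle, matching the two powers in
        \<open>?S\<close>.\<close>
      then have "(\<Prod>e\<in>E. ?f (s e) (t e)) = ?f x w * ?f x y * ?f x z * ?f w y * ?f w z * ?f y z"
        using assms(1) distinct by (intro prod_complete_graph) (auto simp: V insert_commute)
      also have "\<dots> = 36 ^ 6 * ?S (\<sigma> z) (\<sigma> y) (\<sigma> x)"
        unfolding \<tau>_simps sech_dist_commute[of a] by (simp add: powr_mult)
      finally show ?thesis .
    qed
    finally show ?thesis
      unfolding \<tau>_def by (subst ennreal_mult[symmetric]) (auto intro: ennreal_leI)
  qed
  have "(\<integral>\<^sup>+\<sigma>. ennreal \<bar>\<Prod>e\<in>E. kernel (p e) ((\<sigma>(w := a)) (s e)) ((\<sigma>(w := a)) (t e))\<bar>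
        \<partial>(\<Pi>\<^sub>M v\<in>V - {w}. hyp_volume))
      \<le> (\<integral>\<^sup>+\<sigma>. ennreal (36 ^ 6) * ennreal (?S (\<sigma> z) (\<sigma> y) (\<sigma> x)) \<partial>(\<Pi>\<^sub>M v\<in>V - {w}. hyp_volume))"
    by (intro nn_integral_mono bound)
  also have "\<dots> = ennreal (36 ^ 6) * (\<integral>\<^sup>+\<sigma>. ennreal (?S (\<sigma> z) (\<sigma> y) (\<sigma> x)) \<partial>(\<Pi>\<^sub>M v\<in>{z, y, x}. hyp_volume))"
    unfolding xyz(1)
  proof (rule nn_integral_cmult)
    have [measurable]: "(\<lambda>\<sigma>. \<sigma> v) \<in> borel_measurable (\<Pi>\<^sub>M v\<in>{z, y, x}. hyp_volume)"
      if "v \<in> {z, y, x}" for v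
      using measurable_compose[OF measurable_component_singleton[OF that] measurable_ident_hyp_volume]
      by simp
    show "(\<lambda>\<sigma>. ennreal (?S (\<sigma> z) (\<sigma> y) (\<sigma> x))) \<in> borel_measurable (\<Pi>\<^sub>M v\<in>{z, y, x}. hyp_volume)"
      by measurable
  qed
  also have "(\<integral>\<^sup>+\<sigma>. ennreal (?S (\<sigma> z) (\<sigma> y) (\<sigma> x)) \<partial>(\<Pi>\<^sub>M v\<in>{z, y, x}. hyp_volume))
      = (\<integral>\<^sup>+Z. (\<integral>\<^sup>+Y. (\<integral>\<^sup>+X. ennreal (?S Z Y X) \<partial>hyp_volume) \<partial>hyp_volume) \<partial>hyp_volume)"
  proof (rule nn_integral_PiM_3[OF sigma_finite_hyp_volume xyz(2-4)])
    have [measurable]: "(\<lambda>q. h q) \<in> borel_measurable (hyp_volume \<Otimes>\<^sub>M hyp_volume \<Otimes>\<^sub>M hyp_volume)"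
      if "h \<in> (hyp_volume \<Otimes>\<^sub>M hyp_volume \<Otimes>\<^sub>M hyp_volume) \<rightarrow>\<^sub>M hyp_volume" for h
      using measurable_compose[OF that measurable_ident_hyp_volume] by simp
    show "(\<lambda>(Z, Y, X). ennreal (?S Z Y X)) \<in> borel_measurable (hyp_volume \<Otimes>\<^sub>M hyp_volume \<Otimes>\<^sub>M hyp_volume)"
      by measurable
  qed
  also have "ennreal (36 ^ 6) * \<dots> < \<infinity>"
    using tetrahedron_integral_finite[OF a] by (simp add: ennreal_mult_less_top)
  finally show "(\<integral>\<^sup>+\<sigma>. ennreal \<bar>\<Prod>e\<in>E. kernel (p e) ((\<sigma>(w := a)) (s e)) ((\<sigma>(w := a)) (t e))\<bar>
      \<partial>(\<Pi>\<^sub>M v\<in>V - {w}. hyp_volume)) < \<infinity>" .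
qed

end
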